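(* Let $R$ be a ring with invariant basis number and let $A=\sigma(R)\langle x_1,\dots,x_n\rangle$ be an arbitrary skew $PBW$ extension of $R$, with its semi-graduation $A=\bigoplus_{k\ge0}A_k$. Then: (i) The generalized Hilbert series of $A$ is $$Gh_A(t)=\frac{1}{(1-t)^n}.$$ (ii) $A$ has a generalized Hilbert polynomial, given by $$Gp_A(t)=\frac{1}{(n-1)!}\left[t^{n-1}-s_1t^{n-2}+\cdots+(-1)^rs_rt^{n-r-1}+\cdots+(n-1)!\right],$$ where $s_1,\dots,s_{n-1}$ are the elementary symmetric polynomials in the $n-1$ quantities $1-n,\,2-n,\dots,(n-1)-n$ (the bracket being $\sum_{r=0}^{n-1}(-1)^rs_rt^{n-1-r}$ with $s_0=1$ and constant term $(n-1)!$).
   Context: Let $R$ and $A$ be rings (unital, not necessarily commutative). $A$ is a skew $PBW$ extension of $R$, written $A=\sigma(R)\langle x_1,\dots,x_n\rangle$, if: (1) $R\subseteq A$ (subring); (2) there are finitely many elements $x_1,\dots,x_n\in A$ such that $A$ is a free left $R$-module with basis $\mathrm{Mon}(A)=\{x^\alpha=x_1^{\alpha_1}\cdots x_n^{\alpha_n}\mid \alpha\in\mathbb{N}^n\}$, $\mathbb{N}=\{0,1,2,\dots\}$; (3) for every $1\le i\le n$ and $r\in R-\{0\}$ there is $c_{i,r}\in R-\{0\}$ with $x_ir-c_{i,r}x_i\in R$; (4) for every $1\le i,j\le n$ there is $c_{i,j}\in R-\{0\}$ with $x_jx_i-c_{i,j}x_ix_j\in R+Rx_1+\cdots+Rx_n$.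 The semi-graduation of $A$ is $A=\bigoplus_{k\ge0}A_k$, where $A_k$ is the left $R$-submodule generated by the monomials $x^\alpha$ with $\alpha_1+\cdots+\alpha_n=k$; in particular $A_0=R$. Each $A_k$ is a free left $R$-module of finite dimension, and $\dim_RA_k$ denotes this dimension. The generalized Hilbert series of $A$ is $Gh_A(t):=\sum_{k=0}^\infty(\dim_{A_0}A_k)t^k$. $A$ has a generalized Hilbert polynomial if there is a polynomial $Gp_A(t)\in\mathbb{Q}[t]$ with $\dim_{A_0}A_k=Gp_A(k)$ for all sufficiently large $k$; then $Gp_A(t)$ is called the generalized Hilbert polynomial of $A$. *)

theory Defs
  imports "HOL-Computational_Algebra.Computational_Algebra"
begin

text \<open>The ring \<open>A\<close> is the whole type \<open>'a :: ring_1\<close>, and \<open>R\<close> is a subset of it.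
  The class \<open>ring_1\<close> excludes only the zero ring, which does not have invariant basis number.\<close>

definition is_subring :: "'a::ring_1 set \<Rightarrow> bool" where
  "is_subring R \<longleftrightarrow> 1 \<in> R \<and> (\<forall>a\<in>R. \<forall>b\<in>R. a - b \<in> R \<and> a * b \<in> R)"

definition left_span :: "'a::ring_1 set \<Rightarrow> 'i set \<Rightarrow> ('i \<Rightarrow> 'a) \<Rightarrow> 'a set" where
  "left_span R I b = {\<Sum>i\<in>F. c i * b i | F c. finite F \<and> F \<subseteq> I \<and> (\<forall>i\<in>F. c i \<in> R)}"

definition left_independent :: "'a::ring_1 set \<Rightarrow> 'i set \<Rightarrow> ('i \<Rightarrow> 'a) \<Rightarrow> bool" where
  "left_independent R I b \<longleftrightarrow>
     (\<forall>F c. finite F \<and> F \<subseteq> I \<and> (\<forall>i\<in>F. c i \<in> R) \<and> (\<Sum>i\<in>F. c i * b i) = 0 \<longrightarrow> (\<forall>i\<in>F. c i = 0))"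

text \<open>A basis is an indexed family, so that repetitions are excluded.\<close>

definition left_basis :: "'a::ring_1 set \<Rightarrow> 'i set \<Rightarrow> ('i \<Rightarrow> 'a) \<Rightarrow> 'a set \<Rightarrow> bool" where
  "left_basis R I b M \<longleftrightarrow> left_independent R I b \<and> left_span R I b = M"

text \<open>The dimension is meaningful for a module with a finite basis over a ring with invariant
  basis number; otherwise the description need not denote.\<close>

definition left_dim :: "'a::ring_1 set \<Rightarrow> 'a set \<Rightarrow> nat" where
  "left_dim R M = (THE m. \<exists>b. left_basis R {..<m} b M)"

text \<open>\<open>R\<^sup>m\<close>, with vectors padded by zeros outside \<open>{..<m}\<close>.\<close>

definition free_module :: "'a::ring_1 set \<Rightarrow> nat \<Rightarrow> (nat \<Rightarrow> 'a) set" where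
  "free_module R m = {v. (\<forall>i<m. v i \<in> R) \<and> (\<forall>i\<ge>m. v i = 0)}"

definition free_modules_isomorphic :: "'a::ring_1 set \<Rightarrow> nat \<Rightarrow> nat \<Rightarrow> bool" where
  "free_modules_isomorphic R m k \<longleftrightarrow>
     (\<exists>f. bij_betw f (free_module R m) (free_module R k) \<and>
          (\<forall>u\<in>free_module R m. \<forall>v\<in>free_module R m. f (\<lambda>i. u i + v i) = (\<lambda>i. f u i + f v i)) \<and>
          (\<forall>r\<in>R. \<forall>u\<in>free_module R m. f (\<lambda>i. r * u i) = (\<lambda>i. r * f u i)))"

definition invariant_basis_number :: "'a::ring_1 set \<Rightarrow> bool" where
  "invariant_basis_number R \<longleftrightarrow> (\<forall>m k. free_modules_isomorphic R m k \<longrightarrow> m = k)"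

text \<open>The variables are \<open>x 1, \<dots>, x n\<close>; values of \<open>x\<close> at other indices play no role.
  Exponent vectors vanish outside \<open>{1..n}\<close>.\<close>

definition exponents :: "nat \<Rightarrow> (nat \<Rightarrow> nat) set" where
  "exponents n = {\<alpha>. \<forall>i. i \<notin> {1..n} \<longrightarrow> \<alpha> i = 0}"

definition mon :: "nat \<Rightarrow> (nat \<Rightarrow> 'a::ring_1) \<Rightarrow> (nat \<Rightarrow> nat) \<Rightarrow> 'a" where
  "mon n x \<alpha> = prod_list (map (\<lambda>i. x i ^ \<alpha> i) [1..<Suc n])"

definition linear_part :: "'a::ring_1 set \<Rightarrow> nat \<Rightarrow> (nat \<Rightarrow> 'a) \<Rightarrow> 'a set" where
  "linear_part R n x = {r 0 + (\<Sum>i=1..n. r i * x i) | r. \<forall>i\<in>{0..n}. r i \<in> R}"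

definition skew_PBW :: "'a::ring_1 set \<Rightarrow> nat \<Rightarrow> (nat \<Rightarrow> 'a) \<Rightarrow> bool" where
  "skew_PBW R n x \<longleftrightarrow>
     is_subring R \<and>
     left_basis R (exponents n) (mon n x) UNIV \<and>
     (\<forall>i\<in>{1..n}. \<forall>r\<in>R - {0}. \<exists>c\<in>R - {0}. x i * r - c * x i \<in> R) \<and>
     (\<forall>i\<in>{1..n}. \<forall>j\<in>{1..n}. \<exists>c\<in>R - {0}. x j * x i - c * x i * x j \<in> linear_part R n x)"

definition graded_part :: "'a::ring_1 set \<Rightarrow> nat \<Rightarrow> (nat \<Rightarrow> 'a) \<Rightarrow> nat \<Rightarrow> 'a set" where
  "graded_part R n x k = left_span R {\<alpha> \<in> exponents n. (\<Sum>i=1..n. \<alpha> i) = k} (mon n x)"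

definition graded_dim :: "'a::ring_1 set \<Rightarrow> nat \<Rightarrow> (nat \<Rightarrow> 'a) \<Rightarrow> nat \<Rightarrow> nat" where
  "graded_dim R n x k = left_dim (graded_part R n x 0) (graded_part R n x k)"

definition Gh :: "'a::ring_1 set \<Rightarrow> nat \<Rightarrow> (nat \<Rightarrow> 'a) \<Rightarrow> rat fps" where
  "Gh R n x = Abs_fps (\<lambda>k. of_nat (graded_dim R n x k))"

definition is_Gp :: "'a::ring_1 set \<Rightarrow> nat \<Rightarrow> (nat \<Rightarrow> 'a) \<Rightarrow> rat poly \<Rightarrow> bool" where
  "is_Gp R n x p \<longleftrightarrow> (\<exists>k0. \<forall>k\<ge>k0. of_nat (graded_dim R n x k) = poly p (of_nat k))"

definition has_Gp :: "'a::ring_1 set \<Rightarrow> nat \<Rightarrow> (nat \<Rightarrow> 'a) \<Rightarrow> bool" where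
  "has_Gp R n x \<longleftrightarrow> (\<exists>p. is_Gp R n x p)"

definition Gp :: "'a::ring_1 set \<Rightarrow> nat \<Rightarrow> (nat \<Rightarrow> 'a) \<Rightarrow> rat poly" where
  "Gp R n x = (THE p. is_Gp R n x p)"

text \<open>The \<open>r\<close>-th elementary symmetric polynomial in the family \<open>(q i)\<close>, \<open>i \<in> I\<close>.\<close>

definition elem_sym :: "nat \<Rightarrow> 'i set \<Rightarrow> ('i \<Rightarrow> 'b::comm_ring_1) \<Rightarrow> 'b" where
  "elem_sym r I q = (\<Sum>S | S \<subseteq> I \<and> card S = r. \<Prod>i\<in>S. q i)"

end

theory Submission
  imports Defs
begin

text \<open>
  The standard monomials of a skew PBW extension form a left \<open>R\<close>-basis, so the theorem is a count:
  the degree \<open>k\<close> part is free on the monomials of total degree \<open>k\<close>. There are \<open>(k + n - 1) choose k\<close> of them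
  (\<open>card_exponents_of_degree\<close>), and over a ring with invariant basis number this count is \<^emph>\<open>the\<close>
  dimension, because bases with \<open>p\<close> and \<open>q\<close> elements identify the module with \<open>R\<^sup>p\<close> and with \<open>R\<^sup>q\<close>
  and so make these isomorphic (\<open>left_bases_same_size\<close>).

  For the series, \<open>(k + n - 1) choose k\<close> is the coefficient of \<open>t^k\<close> in \<open>1 / (1 - t) ^ n\<close>.
  For the polynomial, let \<open>n \<ge> 1\<close> and put \<open>m = n - 1\<close>. Then
  \<open>(k + m) choose k = (k + 1) \<dots> (k + m) / m!\<close> is a polynomial in \<open>k\<close> whose roots \<open>-1, \<dots>, -m\<close> are
  the numbers \<open>j - n\<close> for \<open>j = 1, \<dots>, m\<close>. Vieta's formula (\<open>prod_linear_factors_eq_elem_sym\<close>)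
  rewrites the product in terms of their elementary symmetric polynomials, and evaluating at \<open>0\<close>
  shows that the constant term is \<open>m!\<close>. No other polynomial qualifies, since a polynomial is
  determined by its values at all large natural numbers.
\<close>

section \<open>Invariance of the number of basis elements\<close>

lemma left_spanI:
  assumes "finite F" "F \<subseteq> I" "\<forall>i\<in>F. c i \<in> R"
  shows "(\<Sum>i\<in>F. c i * b i) \<in> left_span R I b"
  unfolding left_span_def
  by (rule CollectI, rule exI[of _ F], rule exI[of _ c]) (use assms in simp)

lemma left_spanE:
  assumes "y \<in> left_span R I b"
  obtains F c where "finite F" "F \<subseteq> I" "\<forall>i\<in>F. c i \<in> R" "y = (\<Sum>i\<in>F. c i * b i)"
  using assms unfolding left_span_def by blast

lemma left_independentD:
  assumes "left_independent R I b" "finite F" "F \<subseteq> I" "\<forall>i\<in>F. c i \<in> R"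
    and "(\<Sum>i\<in>F. c i * b i) = 0"
  shows "\<forall>i\<in>F. c i = 0"
  using assms(1)[unfolded left_independent_def, THEN spec[of _ F], THEN spec[of _ c]] assms(2-5)
  by simp

lemma left_independent_subset:
  assumes "left_independent R I b" "J \<subseteq> I"
  shows "left_independent R J b"
  unfolding left_independent_def
proof (intro allI impI)
  fix F c
  assume "finite F \<and> F \<subseteq> J \<and> (\<forall>i\<in>F. c i \<in> R) \<and> (\<Sum>i\<in>F. c i * b i) = 0"
  then show "\<forall>i\<in>F. c i = 0"
    using assms(2) by (intro left_independentD[OF assms(1)]) auto
qed

definition combination :: "(nat \<Rightarrow> 'a::ring_1) \<Rightarrow> nat \<Rightarrow> (nat \<Rightarrow> 'a) \<Rightarrow> 'a" where
  "combination b m v = (\<Sum>i<m. v i * b i)"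

lemma combination_add:
  "combination b m (\<lambda>i. u i + v i) = combination b m u + combination b m v"
  by (simp add: combination_def distrib_right sum.distrib)

lemma combination_scale:
  "combination b m (\<lambda>i. r * v i) = r * combination b m v"
  by (simp add: combination_def sum_distrib_left mult.assoc)

lemma is_subring_zero: "is_subring R \<Longrightarrow> 0 \<in> R"
  unfolding is_subring_def by (metis diff_self)

lemma is_subring_add:
  assumes "is_subring R" "a \<in> R" "b \<in> R"
  shows "a + b \<in> R"
proof -
  have "0 - b \<in> R" using assms is_subring_zero unfolding is_subring_def by metis
  then have "a - (0 - b) \<in> R" using assms unfolding is_subring_def by metis
  then show ?thesis by simp
qed

lemma free_module_add:
  assumes "is_subring R" "u \<in> free_module R m" "v \<in> free_module R m"
  shows "(\<lambda>i. u i + v i) \<in> free_module R m"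
  using assms by (auto simp: free_module_def is_subring_add)

lemma free_module_scale:
  assumes "is_subring R" "r \<in> R" "v \<in> free_module R m"
  shows "(\<lambda>i. r * v i) \<in> free_module R m"
  using assms by (auto simp: free_module_def is_subring_def)

lemma bij_betw_combination:
  assumes R: "is_subring R" and b: "left_basis R {..<m} b M"
  shows "bij_betw (combination b m) (free_module R m) M"
  unfolding bij_betw_def
proof
  show "inj_on (combination b m) (free_module R m)"
  proof (rule inj_onI)
    fix u v assume u: "u \<in> free_module R m" and v: "v \<in> free_module R m"
      and eq: "combination b m u = combination b m v"
    have "(\<Sum>i<m. (u i - v i) * b i) = 0"
      using eq by (simp add: combination_def left_diff_distrib sum_subtractf)
    moreover have "\<forall>i\<in>{..<m}. u i - v i \<in> R"
      using u v R by (auto simp: free_module_def is_subring_def)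
    moreover have "left_independent R {..<m} b"
      using b by (simp add: left_basis_def)
    ultimately have "\<forall>i\<in>{..<m}. u i - v i = 0"
      by (intro left_independentD[where I = "{..<m}"]) simp_all
    then show "u = v"
      using u v by (force simp: free_module_def fun_eq_iff not_less[symmetric])
  qed
next
  have M: "M = left_span R {..<m} b"
    using b by (simp add: left_basis_def)
  show "combination b m ` free_module R m = M"
  proof (intro equalityI subsetI)
    fix y assume "y \<in> combination b m ` free_module R m"
    then obtain v where v: "v \<in> free_module R m" and y: "y = combination b m v" by blast
    show "y \<in> M"
      unfolding M y combination_def using v by (intro left_spanI) (auto simp: free_module_def)
  next
    fix y assume "y \<in> M"
    then obtain F c where F: "F \<subseteq> {..<m}" "\<forall>i\<in>F. c i \<in> R" and y: "y = (\<Sum>i\<in>F. c i * b i)"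
      unfolding M by (elim left_spanE)
    define v where "v i = (if i \<in> F then c i else 0)" for i
    have "v \<in> free_module R m"
      using F is_subring_zero[OF R] by (auto simp: v_def free_module_def)
    moreover have "y = combination b m v"
      unfolding y combination_def v_def using F(1)
      by (intro sum.mono_neutral_cong_left) auto
    ultimately show "y \<in> combination b m ` free_module R m" by blast
  qed
qed

text \<open>
  The isomorphism expresses a vector given by its coordinates in the first basis by its coordinates
  in the second one. Its linearity is checked after applying the injective linear map back to \<open>M\<close>.
\<close>

lemma free_modules_isomorphic_if_left_bases:
  assumes R: "is_subring R"
    and b: "left_basis R {..<m} b M" and c: "left_basis R {..<k} c M"
  shows "free_modules_isomorphic R m k"
proof -
  let ?B = "combination b m" and ?C = "combination c k"
  have B: "bij_betw ?B (free_module R m) M" and C: "bij_betw ?C (free_module R k) M"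
    using bij_betw_combination R b c by blast+
  define f where "f u = inv_into (free_module R k) ?C (?B u)" for u
  have f: "bij_betw f (free_module R m) (free_module R k)"
    unfolding f_def using bij_betw_trans[OF B bij_betw_inv_into[OF C]] by (simp add: comp_def)
  have fin: "f u \<in> free_module R k" if "u \<in> free_module R m" for u
    using f that by (auto simp: bij_betw_def)
  have Cf: "?C (f u) = ?B u" if "u \<in> free_module R m" for u
    unfolding f_def using bij_betw_inv_into_right[OF C] B that by (auto simp: bij_betw_def)
  have f_eqI: "f u = v"
    if "u \<in> free_module R m" "v \<in> free_module R k" "?C v = ?B u" for u v
    using C that fin Cf by (metis bij_betw_def inj_onD)
  show ?thesis
    unfolding free_modules_isomorphic_def
  proof (intro exI[of _ f] conjI ballI)
    show "bij_betw f (free_module R m) (free_module R k)" by (fact f)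
  next
    fix u v assume u: "u \<in> free_module R m" and v: "v \<in> free_module R m"
    show "f (\<lambda>i. u i + v i) = (\<lambda>i. f u i + f v i)"
      using u v by (intro f_eqI free_module_add R fin) (simp_all add: combination_add Cf)
  next
    fix r u assume r: "r \<in> R" and u: "u \<in> free_module R m"
    show "f (\<lambda>i. r * u i) = (\<lambda>i. r * f u i)"
      using r u by (intro f_eqI free_module_scale R fin) (simp_all add: combination_scale Cf)
  qed
qed

lemma left_bases_same_size:
  fixes m k :: nat
  assumes "invariant_basis_number R" "is_subring R"
    and "left_basis R {..<m} b M" "left_basis R {..<k} c M"
  shows "m = k"
  using assms(1) free_modules_isomorphic_if_left_bases[OF assms(2-4)]
  by (simp add: invariant_basis_number_def)

lemma left_basis_reindex:
  fixes R :: "'a::ring_1 set" and h :: "'j \<Rightarrow> 'i"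
  assumes h: "bij_betw h J I" and b: "left_basis R I b M"
  shows "left_basis R J (b \<circ> h) M"
proof -
  have inj: "inj_on h J" and img: "h ` J = I"
    using h by (auto simp: bij_betw_def)
  have sum_h: "(\<Sum>j\<in>F. c j * (b \<circ> h) j) = (\<Sum>i\<in>h ` F. c (inv_into J h i) * b i)"
    if "F \<subseteq> J" for F and c :: "'j \<Rightarrow> 'a"
  proof -
    have "inj_on h F" using inj that by (rule inj_on_subset)
    then show ?thesis
      using inj that by (subst sum.reindex) (auto intro!: sum.cong simp: subset_iff)
  qed
  have "left_independent R J (b \<circ> h)"
    unfolding left_independent_def
  proof (intro allI impI ballI)
    fix F c j
    assume F: "finite F \<and> F \<subseteq> J \<and> (\<forall>i\<in>F. c i \<in> R) \<and> (\<Sum>i\<in>F. c i * (b \<circ> h) i) = 0"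
      and j: "j \<in> F"
    have inv: "inv_into J h (h i) = i" if "i \<in> F" for i
      using F inj that by auto
    have "left_independent R I b" using b by (simp add: left_basis_def)
    moreover have "finite (h ` F)" "h ` F \<subseteq> I" "\<forall>i\<in>h ` F. c (inv_into J h i) \<in> R"
      using F img inv by auto
    moreover have "(\<Sum>i\<in>h ` F. c (inv_into J h i) * b i) = 0"
      using F sum_h[of F c] by simp
    ultimately have "\<forall>i\<in>h ` F. c (inv_into J h i) = 0"
      by (rule left_independentD)
    then show "c j = 0" using j inv by auto
  qed
  moreover have "left_span R J (b \<circ> h) = left_span R I b"
  proof (intro equalityI subsetI)
    fix y assume "y \<in> left_span R J (b \<circ> h)"
    then obtain F c where F: "finite F" "F \<subseteq> J" "\<forall>i\<in>F. c i \<in> R"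
      and y: "y = (\<Sum>i\<in>F. c i * (b \<circ> h) i)"
      by (elim left_spanE)
    have "\<forall>i\<in>h ` F. c (inv_into J h i) \<in> R"
      using F inj by (auto simp: subset_iff)
    then show "y \<in> left_span R I b"
      unfolding y sum_h[OF F(2)] using F img by (intro left_spanI) auto
  next
    fix y assume "y \<in> left_span R I b"
    then obtain F c where F: "finite F" "F \<subseteq> I" "\<forall>i\<in>F. c i \<in> R"
      and y: "y = (\<Sum>i\<in>F. c i * b i)"
      by (elim left_spanE)
    let ?G = "inv_into J h ` F"
    have hinv: "h (inv_into J h i) = i" if "i \<in> F" for i
      using F img that by (metis f_inv_into_f subsetD)
    have G: "?G \<subseteq> J" using F img by (auto intro: inv_into_into)
    have "inj_on (inv_into J h) F"
      using hinv by (metis inj_onI)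
    then have "y = (\<Sum>j\<in>?G. c (h j) * (b \<circ> h) j)"
      unfolding y by (subst sum.reindex) (auto intro!: sum.cong simp: hinv)
    moreover have "\<forall>j\<in>?G. c (h j) \<in> R" using F hinv by auto
    ultimately show "y \<in> left_span R J (b \<circ> h)"
      using F G by (simp only:) (intro left_spanI finite_imageI)
  qed
  ultimately show ?thesis using b by (simp add: left_basis_def)
qed

lemma left_dim_eq_card:
  assumes "invariant_basis_number R" "is_subring R" "finite I" "left_basis R I b M"
  shows "left_dim R M = card I"
proof -
  obtain h where "bij_betw h {..<card I} I"
    using ex_bij_betw_nat_finite[OF assms(3)] by (auto simp: atLeast0LessThan)
  then have "left_basis R {..<card I} (b \<circ> h) M"
    using assms(4) by (rule left_basis_reindex)
  then show ?thesis
    unfolding left_dim_def using left_bases_same_size[OF assms(1,2)]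
    by (intro the_equality) blast+
qed

section \<open>Dimensions of the homogeneous parts\<close>

text \<open>
  This reduces counting monomials of a given degree to the known count of lists of natural numbers
  with given length and sum.
\<close>

lemma bij_betw_exponents_lists:
  "bij_betw (\<lambda>\<alpha>. map \<alpha> [1..<Suc n]) {\<alpha> \<in> exponents n. (\<Sum>i=1..n. \<alpha> i) = k}
     {l. length l = n \<and> sum_list l = k}"
proof (rule bij_betw_byWitness[where f' = "\<lambda>l i. if i \<in> {1..n} then l ! (i - 1) else 0"])
  have sum_map: "sum_list (map \<alpha> [1..<Suc n]) = (\<Sum>i=1..n. \<alpha> i)" for \<alpha> :: "nat \<Rightarrow> nat"
    by (simp only: interv_sum_list_conv_sum_set_nat set_upt atLeastLessThanSuc_atLeastAtMost)
  have map_nth: "map (\<lambda>i. if i \<in> {1..n} then l ! (i - 1) else 0) [1..<Suc n] = l"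
    if "length l = n" for l :: "nat list"
    using that by (intro nth_equalityI) (auto simp del: upt_Suc)
  show "\<forall>\<alpha>\<in>{\<alpha> \<in> exponents n. (\<Sum>i=1..n. \<alpha> i) = k}.
      (\<lambda>i. if i \<in> {1..n} then map \<alpha> [1..<Suc n] ! (i - 1) else 0) = \<alpha>"
    by (auto simp: exponents_def fun_eq_iff simp del: upt_Suc)
  show "\<forall>l\<in>{l. length l = n \<and> sum_list l = k}.
      map (\<lambda>i. if i \<in> {1..n} then l ! (i - 1) else 0) [1..<Suc n] = l"
    using map_nth by blast
  show "(\<lambda>\<alpha>. map \<alpha> [1..<Suc n]) ` {\<alpha> \<in> exponents n. (\<Sum>i=1..n. \<alpha> i) = k}
      \<subseteq> {l. length l = n \<and> sum_list l = k}"
    using sum_map by (auto simp del: upt_Suc)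
  show "(\<lambda>l i. if i \<in> {1..n} then l ! (i - 1) else 0) ` {l. length l = n \<and> sum_list l = k}
      \<subseteq> {\<alpha> \<in> exponents n. (\<Sum>i=1..n. \<alpha> i) = k}"
  proof (intro image_subsetI CollectI conjI)
    fix l :: "nat list" assume l: "l \<in> {l. length l = n \<and> sum_list l = k}"
    let ?\<alpha> = "\<lambda>i. if i \<in> {1..n} then l ! (i - 1) else 0"
    show "?\<alpha> \<in> exponents n" by (auto simp: exponents_def)
    show "(\<Sum>i=1..n. ?\<alpha> i) = k"
      using l map_nth[of l] sum_map[of ?\<alpha>] by simp
  qed
qed

lemma finite_exponents_of_degree: "finite {\<alpha> \<in> exponents n. (\<Sum>i=1..n. \<alpha> i) = k}"
proof -
  have "{l :: nat list. length l = n \<and> sum_list l = k} \<subseteq> {l. set l \<subseteq> {..k} \<and> length l = n}"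
    using member_le_sum_list by fastforce
  then have "finite {l :: nat list. length l = n \<and> sum_list l = k}"
    using finite_lists_length_eq[of "{..k}" n] finite_subset by blast
  then show ?thesis using bij_betw_finite[OF bij_betw_exponents_lists] by blast
qed

lemma card_exponents_of_degree:
  "card {\<alpha> \<in> exponents n. (\<Sum>i=1..n. \<alpha> i) = k} = (k + n - 1) choose k"
  using bij_betw_same_card[OF bij_betw_exponents_lists[of n k]] by (simp add: card_length_sum_list)

lemma graded_part_0:
  assumes "is_subring R"
  shows "graded_part R n x 0 = R"
proof -
  have I: "{\<alpha> \<in> exponents n. (\<Sum>i=1..n. \<alpha> i) = 0} = {\<lambda>_. 0}"
    by (force simp: exponents_def fun_eq_iff)
  have mon: "mon n x (\<lambda>_. 0) = 1"
    unfolding mon_def by (induction n) auto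
  show ?thesis
    unfolding graded_part_def I
  proof (intro equalityI subsetI)
    fix y assume "y \<in> left_span R {\<lambda>_. 0} (mon n x)"
    then obtain F c where "F \<subseteq> {\<lambda>_. 0}" "\<forall>i\<in>F. c i \<in> R" "y = (\<Sum>i\<in>F. c i * mon n x i)"
      by (elim left_spanE)
    then show "y \<in> R"
      using mon is_subring_zero[OF assms] by (auto simp: subset_singleton_iff)
  next
    fix y assume "y \<in> R"
    then show "y \<in> left_span R {\<lambda>_. 0} (mon n x)"
      using left_spanI[of "{\<lambda>_. 0}" "{\<lambda>_. 0}" "\<lambda>_. y" R "mon n x"] mon by simp
  qed
qed

lemma graded_dim_eq:
  assumes ibn: "invariant_basis_number R" and A: "skew_PBW R n x"
  shows "graded_dim R n x k = (k + n - 1) choose k"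
proof -
  let ?I = "{\<alpha> \<in> exponents n. (\<Sum>i=1..n. \<alpha> i) = k}"
  have R: "is_subring R" using A by (simp add: skew_PBW_def)
  have "left_independent R (exponents n) (mon n x)"
    using A by (simp add: skew_PBW_def left_basis_def)
  moreover have "?I \<subseteq> exponents n" by blast
  ultimately have "left_independent R ?I (mon n x)"
    by (rule left_independent_subset)
  then have "left_basis R ?I (mon n x) (graded_part R n x k)"
    by (simp add: left_basis_def graded_part_def)
  then have "left_dim R (graded_part R n x k) = card ?I"
    by (rule left_dim_eq_card[OF ibn R finite_exponents_of_degree])
  then show ?thesis
    by (simp only: graded_dim_def graded_part_0[OF R] card_exponents_of_degree)
qed

section \<open>The Hilbert series and the Hilbert polynomial\<close>

lemma one_over_one_minus_fps_X_power:
  "1 / (1 - fps_X) ^ n = (Abs_fps (\<lambda>k. of_nat ((k + n - 1) choose k)) :: 'a::field_char_0 fps)"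
proof (cases "n = 0")
  case True
  \<comment> \<open>Truncated subtraction makes the coefficient \<open>(k - 1) choose k\<close>, which is \<open>0\<close> except at \<open>k = 0\<close>.\<close>
  have "Abs_fps (\<lambda>k. of_nat ((k - 1) choose k)) = (1 :: 'a fps)"
    by (rule fps_ext) simp
  then show ?thesis using True by simp
next
  case False
  have "1 / (1 - fps_X) ^ n = (inverse ((1 - fps_X) ^ n) :: 'a fps)"
    by (subst fps_divide_unit) (simp_all add: fps_power_zeroth)
  also have "\<dots> = Abs_fps (\<lambda>k. of_nat ((k + n - 1) choose k))"
    using False one_minus_const_fps_X_neg_power'[of n "1 :: 'a"] by (simp add: add.commute)
  finally show ?thesis .
qed

text \<open>Vieta: expanding the product, the factors that contribute a root form the set \<open>S\<close>.\<close>

lemma prod_linear_factors_eq_elem_sym: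
  fixes q :: "'i \<Rightarrow> 'b::comm_ring_1"
  assumes I: "finite I"
  shows "(\<Prod>i\<in>I. [:- q i, 1:]) =
    (\<Sum>r=0..card I. monom ((- 1) ^ r * elem_sym r I q) (card I - r))"
proof -
  let ?t = "\<lambda>S. monom ((- 1) ^ card S * (\<Prod>i\<in>S. q i)) (card I - card S)"
  have "(\<Prod>i\<in>I. [:- q i, 1:]) = (\<Prod>i\<in>I. [:- q i:] + monom 1 1)"
    by (simp add: monom_altdef)
  also have "\<dots> = (\<Sum>S\<in>Pow I. (\<Prod>i\<in>S. [:- q i:]) * (\<Prod>i\<in>I - S. monom 1 1))"
    using I by (rule prod_add)
  also have "\<dots> = (\<Sum>S\<in>Pow I. ?t S)"
  proof (rule sum.cong[OF refl])
    fix S assume "S \<in> Pow I"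
    then have "card (I - S) = card I - card S"
      using I by (simp add: card_Diff_subset finite_subset)
    moreover have "(\<Prod>i\<in>S. [:- q i:]) = [:\<Prod>i\<in>S. - q i:]"
      by (induction S rule: infinite_finite_induct) (simp_all add: one_pCons mult.commute)
    ultimately show "(\<Prod>i\<in>S. [:- q i:]) * (\<Prod>i\<in>I - S. monom 1 1) = ?t S"
      by (simp add: monom_power smult_monom prod_uminus)
  qed
  also have "\<dots> = (\<Sum>r=0..card I. \<Sum>S\<in>{S \<in> Pow I. card S = r}. ?t S)"
    using I by (intro sum.group[symmetric]) (auto intro: card_mono)
  also have "\<dots> = (\<Sum>r=0..card I. monom ((- 1) ^ r * elem_sym r I q) (card I - r))"
    by (intro sum.cong refl) (simp add: elem_sym_def sum_distrib_left monom_sum)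
  finally show ?thesis .
qed

lemma fact_mult_prod_shift:
  "fact k * (\<Prod>j=1..m. of_nat k + of_nat j) = (fact (k + m) :: 'a::field_char_0)"
proof (induction m)
  case (Suc m)
  have "fact k * (\<Prod>j=1..Suc m. of_nat k + of_nat j) =
      (fact k * (\<Prod>j=1..m. of_nat k + of_nat j)) * (of_nat (Suc (k + m)) :: 'a)"
    by (simp add: mult_ac add_ac)
  also have "\<dots> = fact (k + Suc m)"
    unfolding Suc by (simp add: mult.commute)
  finally show ?case .
qed simp

lemma poly_eqI_of_nat:
  fixes p q :: "'a::{idom,ring_char_0} poly"
  assumes "\<And>k. k \<ge> k0 \<Longrightarrow> poly p (of_nat k) = poly q (of_nat k)"
  shows "p = q"
proof (rule ccontr)
  assume "p \<noteq> q"
  then have "finite {z. poly (p - q) z = 0}" by (intro poly_roots_finite) simp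
  moreover have "of_nat ` {k0..} \<subseteq> {z. poly (p - q) z = 0}" using assms by auto
  ultimately have "finite (of_nat ` {k0..} :: 'a set)" by (rule rev_finite_subset)
  then have "finite {k0..}" by (rule finite_imageD) (simp add: inj_on_def)
  then show False using infinite_Ici by blast
qed

lemma Gp_eqI:
  assumes "is_Gp R n x p"
  shows "Gp R n x = p"
  unfolding Gp_def
proof (rule the_equality)
  fix q assume "is_Gp R n x q"
  then obtain k0 k1 where "\<forall>k\<ge>k0. of_nat (graded_dim R n x k) = poly p (of_nat k)"
    "\<forall>k\<ge>k1. of_nat (graded_dim R n x k) = poly q (of_nat k)"
    using assms unfolding is_Gp_def by blast
  then show "q = p" by (intro poly_eqI_of_nat[of "max k0 k1"]) (metis max.boundedE)
qed (fact assms)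

theorem theorem3p3:
  fixes R :: "'a::ring_1 set" and n :: nat and x :: "nat \<Rightarrow> 'a" and s :: "nat \<Rightarrow> rat"
  assumes "invariant_basis_number R"
    and "skew_PBW R n x"
    and s: "\<And>r. s r = elem_sym r {1..n - 1} (\<lambda>j. of_nat j - of_nat n)"
  shows "Gh R n x = 1 / (1 - fps_X) ^ n \<and>
    (n \<ge> 1 \<longrightarrow>
       has_Gp R n x \<and>
       Gp R n x = smult (1 / fact (n - 1))
         (\<Sum>r=0..n - 1. monom ((- 1) ^ r * s r) (n - 1 - r)) \<and>
       (- 1) ^ (n - 1) * s (n - 1) = fact (n - 1))"
proof (intro conjI impI)
  note dim = graded_dim_eq[OF assms(1,2)]
  show "Gh R n x = 1 / (1 - fps_X) ^ n"
    by (simp add: Gh_def dim one_over_one_minus_fps_X_power)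
  assume n: "n \<ge> 1"
  define m where "m = n - 1"
  let ?V = "\<Sum>r=0..n - 1. monom ((- 1) ^ r * s r) (n - 1 - r)"
  have "?V = (\<Prod>j\<in>{1..m}. [:- (of_nat j - of_nat n), 1:])"
    using prod_linear_factors_eq_elem_sym[of "{1..m}" "\<lambda>j. of_nat j - of_nat n :: rat"]
    by (simp add: s m_def)
  then have "poly ?V (of_nat k) = (\<Prod>j\<in>{1..m}. of_nat k + of_nat (m + 1 - j))" for k
    using n by (simp only: poly_prod) (auto intro!: prod.cong simp: m_def)
  \<comment> \<open>The root \<open>j - n\<close> is \<open>- (m + 1 - j)\<close>, so the roots are listed from \<open>-m\<close> up to \<open>-1\<close>.\<close>
  then have V: "poly ?V (of_nat k) = (\<Prod>j\<in>{1..m}. of_nat k + of_nat j)" for k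
    using prod.atLeastAtMost_rev[of "\<lambda>j. of_nat k + of_nat j :: rat" 1 m] by (simp add: add.commute)
  have "is_Gp R n x (smult (1 / fact (n - 1)) ?V)"
    unfolding is_Gp_def
  proof (intro exI[of _ 0] allI impI)
    fix k :: nat
    have "of_nat (graded_dim R n x k) = (fact (k + m) / (fact k * fact m) :: rat)"
      using n by (simp add: dim m_def binomial_fact)
    also have "\<dots> = poly (smult (1 / fact m) ?V) (of_nat k)"
      unfolding poly_smult V fact_mult_prod_shift[symmetric] by simp
    finally show "of_nat (graded_dim R n x k) = poly (smult (1 / fact (n - 1)) ?V) (of_nat k)"
      by (simp add: m_def)
  qed
  then show "has_Gp R n x" and "Gp R n x = smult (1 / fact (n - 1)) ?V"
    by (auto simp: has_Gp_def intro: Gp_eqI)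
  have "poly ?V 0 = (- 1) ^ (n - 1) * s (n - 1)"
  proof -
    have "poly ?V 0 = (\<Sum>r=0..n - 1. if r = n - 1 then (- 1) ^ r * s r else 0)"
      unfolding poly_sum by (intro sum.cong) (auto simp: poly_monom)
    then show ?thesis by simp
  qed
  moreover have "poly ?V 0 = fact (n - 1)"
    using V[of 0] fact_mult_prod_shift[of 0 m, where 'a = rat] by (simp add: m_def)
  ultimately show "(- 1) ^ (n - 1) * s (n - 1) = fact (n - 1)" by simp
qed

end
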